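(* Let $a\ge 0$, $0<\mu<\tfrac12$, $c>0$, $T>0$, and let $e:[0,T]\to\mathbb{R}$ be continuous. Write $e_*=\min_{t\in[0,T]}e(t)$ and $e^*=\max_{t\in[0,T]}e(t)$. Suppose that $e_*>0$ and that $m>0$ is such that $$\frac{c^2}{\mu\,e_*^2}\left(\frac{1}{c_m^{\mu}}\,e^*-e_*\right)\le m^2<\left(\frac{\pi}{T}\right)^2+\left(\frac a2\right)^2,$$ where $c_m$ is the constant described in the context. Then the problem $$x''(t)+a\,x'(t)=\frac{e(t)}{\mu}\,x^{1-2\mu}(t)-\frac{c}{\mu}\,x^{1-\mu}(t),\quad t\in[0,T],\qquad x(0)=x(T),\quad x'(0)=x'(T),$$ has a positive solution $x$ such that $$0<x(t)\le\frac{1}{c_m}\left(\frac{e^*}{c}\right)^{\frac1\mu}\quad\text{for all } t\in[0,T].$$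
   Context: For $a\ge0$ and $0<m<\sqrt{(\pi/T)^2+(a/2)^2}$, $G_m:[0,T]\times[0,T]\to\mathbb{R}$ denotes the Green's function of the linear periodic problem $x''+a x'+m^2x=h(t)$ on $[0,T]$, $x(0)=x(T)$, $x'(0)=x'(T)$; i.e. for each continuous $h$ on $[0,T]$, the function $x(t)=\int_0^TG_m(t,\tau)h(\tau)\,d\tau$ is the unique solution of this problem. It is known that $G_m$ exists and is unique, that $G_m>0$ on $[0,T]\times[0,T]$, that $\int_0^TG_m(t,\tau)\,d\tau=1/m^2$ for all $t\in[0,T]$, and that there is a constant in $(0,1)$, fixed and denoted $c_m$, such that $G_m(t,\tau)\ge G_m(\tau,\tau)\ge c_m\,G_m(t,\tau)$ for all $(t,\tau)\in[0,T]\times[0,T]$.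
   Formalization: The Green's function G_m is taken for x''+a x'+m²x=h; the term "a x" in the context's linear equation is a misprint, since for a>0 it contradicts ∫G_m=1/m² and G_m may not exist (T=2π, a=0.9, m²=0.1). G_m is understood to be jointly continuous, which makes it unique. *)

theory Defs
  imports "HOL-Analysis.Analysis"
begin

text \<open>
  The relation \<open>P t (x t) (x' t) (x'' t)\<close> is the differential equation. Derivatives are taken
  within \<open>{0..T}\<close>, hence one-sided at the end points; for \<open>T > 0\<close> they are unique.
\<close>

definition periodic_solution ::
    "real \<Rightarrow> (real \<Rightarrow> real \<Rightarrow> real \<Rightarrow> real \<Rightarrow> bool) \<Rightarrow> (real \<Rightarrow> real) \<Rightarrow> bool" where
  "periodic_solution T P x \<longleftrightarrow>
     (\<exists>x' x''.
        (\<forall>t\<in>{0..T}. (x has_real_derivative x' t) (at t within {0..T})) \<and>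
        (\<forall>t\<in>{0..T}. (x' has_real_derivative x'' t) (at t within {0..T})) \<and>
        (\<forall>t\<in>{0..T}. P t (x t) (x' t) (x'' t)) \<and>
        x 0 = x T \<and> x' 0 = x' T)"

text \<open>
  Green's function of \<open>x'' + a x' + m\<^sup>2 x = h(t)\<close> with periodic boundary conditions.
  The integral representation alone determines \<open>G t\<close> only up to null sets; joint continuity
  selects the unique pointwise representative, so that the diagonal values \<open>G \<tau> \<tau>\<close>
  are meaningful. Values of \<open>G\<close> outside the square are irrelevant.
\<close>

definition periodic_green :: "real \<Rightarrow> real \<Rightarrow> real \<Rightarrow> (real \<Rightarrow> real \<Rightarrow> real) \<Rightarrow> bool" where
  "periodic_green T a m G \<longleftrightarrow>
     continuous_on ({0..T} \<times> {0..T}) (\<lambda>(t, \<tau>). G t \<tau>) \<and>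
     (\<forall>h. continuous_on {0..T} h \<longrightarrow>
        periodic_solution T (\<lambda>t u u' u''. u'' + a * u' + m\<^sup>2 * u = h t)
          (\<lambda>t. integral {0..T} (\<lambda>\<tau>. G t \<tau> * h \<tau>)) \<and>
        (\<forall>y. periodic_solution T (\<lambda>t u u' u''. u'' + a * u' + m\<^sup>2 * u = h t) y \<longrightarrow>
           (\<forall>t\<in>{0..T}. y t = integral {0..T} (\<lambda>\<tau>. G t \<tau> * h \<tau>))))"

end

theory Submission
  imports Defs "HOL-Complex_Analysis.Great_Picard"
begin

text \<open>
  Adding \<open>m\<^sup>2 x\<close> to both sides turns the problem into the fixed point equation \<open>x = F x\<close> with
  \<open>F x t = \<integral> G t \<tau> * f \<tau> (x \<tau>) d\<tau>\<close> and
  \<open>f t u = m\<^sup>2 u + e t / \<mu> * u powr (1 - 2\<mu>) - c / \<mu> * u powr (1 - \<mu>)\<close>. Put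
  \<open>R = 1 / c\<^sub>m * (e_max / c) powr (1 / \<mu>)\<close>. Three properties of \<open>f\<close> on \<open>0 < u \<le> R\<close> matter; with
  \<open>y = u powr (- \<mu>)\<close> they are all read off from \<open>f t u = u (m\<^sup>2 - y (c - e t * y) / \<mu>)\<close>.

  First, \<open>f t u \<ge> \<rho> u\<close> for a constant \<open>\<rho> > 0\<close>: on the range \<open>y \<ge> R powr (- \<mu>)\<close> the parabola
  \<open>y (c - e t * y)\<close> stays strictly below \<open>\<mu> m\<^sup>2\<close> (lemma \<open>concave_parabola_bound\<close>), by
  the lower bound imposed on \<open>m\<^sup>2\<close>; strictness comes from \<open>c\<^sub>m < 1\<close>. Second, \<open>f t u \<ge> m\<^sup>2 u\<close>
  when \<open>u\<close> is below \<open>(e_min / c) powr (1 / \<mu>)\<close>. Third, \<open>f t u \<le> m\<^sup>2 u\<close> when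
  \<open>u \<ge> (e_max / c) powr (1 / \<mu>) = c\<^sub>m R\<close>.
  Since \<open>G t\<close> has total mass \<open>1 / m\<^sup>2\<close>, the first two give a small \<open>\<delta> > 0\<close>
  such that \<open>\<delta> \<le> x \<le> R\<close> implies \<open>F x \<ge> \<delta>\<close>.

  The upper bound \<open>R\<close> need not be invariant under \<open>F\<close>, so the truncated operator
  \<open>\<Phi> x = min (F x) R\<close> is used instead, which maps the order interval \<open>[\<delta>, R]\<close> into itself and has
  a fixed point by a Schauder theorem for order intervals of continuous functions
  (\<open>schauder_order_interval\<close>). The truncation turns out to be inactive
  (\<open>periodic_solution_in_order_interval\<close>): the inequalities for \<open>G\<close> give the cone property
  \<open>F x s \<ge> c\<^sub>m * F x t\<close>, so if \<open>F x\<close> exceeded \<open>R\<close> anywhere, then \<open>x \<ge> c\<^sub>m R\<close>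
  everywhere, where \<open>f \<le> m\<^sup>2 R\<close>, and integration against \<open>G\<close> would give \<open>F x \<le> R\<close>.

  Schauder's theorem is reduced to finite dimensions by a partition of unity, and there Sperner's
  argument in Kuhn's form yields approximate fixed points in cubes of arbitrary dimension. The
  Arzela-Ascoli theorem turns approximate fixed points into an exact one.
\<close>

section \<open>A Schauder fixed point theorem for order intervals\<close>

text \<open>
  Cubes are sets of functions on \<open>nat\<close> restricted to indices below \<open>n\<close>, so that the dimension
  is a number and can grow with the accuracy of a discretization. On a fine grid, label a point \<open>0\<close> in
  coordinate \<open>i\<close> if \<open>\<Psi>\<close> does not decrease that coordinate, and \<open>1\<close> if it does not increase it.
  Kuhn's lemma finds a grid cell on which both labels occur in every coordinate, and on a cell as
  small as that uniform continuity makes the displacement in every coordinate small.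
\<close>

lemma approximate_fixed_point_box:
  fixes \<Psi> :: "(nat \<Rightarrow> real) \<Rightarrow> nat \<Rightarrow> real" and lo hi \<epsilon> :: real
  assumes "lo \<le> hi" "\<epsilon> > 0"
    and maps: "\<And>v i. \<lbrakk>\<And>j. j < n \<Longrightarrow> v j \<in> {lo..hi}; i < n\<rbrakk> \<Longrightarrow> \<Psi> v i \<in> {lo..hi}"
    and ucont: "\<And>\<epsilon>. \<epsilon> > 0 \<Longrightarrow> \<exists>\<eta>>0. \<forall>u v. (\<forall>j<n. u j \<in> {lo..hi}) \<longrightarrow> (\<forall>j<n. v j \<in> {lo..hi}) \<longrightarrow>
              (\<forall>j<n. \<bar>u j - v j\<bar> \<le> \<eta>) \<longrightarrow> (\<forall>i<n. \<bar>\<Psi> u i - \<Psi> v i\<bar> \<le> \<epsilon>)"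
  obtains v where "\<And>j. j < n \<Longrightarrow> v j \<in> {lo..hi}" "\<And>i. i < n \<Longrightarrow> \<bar>\<Psi> v i - v i\<bar> \<le> \<epsilon>"
proof -
  obtain \<eta> where "\<eta> > 0" and \<eta>: "\<And>u v i. \<lbrakk>\<forall>j<n. u j \<in> {lo..hi}; \<forall>j<n. v j \<in> {lo..hi};
      \<forall>j<n. \<bar>u j - v j\<bar> \<le> \<eta>; i < n\<rbrakk> \<Longrightarrow> \<bar>\<Psi> u i - \<Psi> v i\<bar> \<le> \<epsilon> / 2"
    using ucont[of "\<epsilon> / 2"] \<open>\<epsilon> > 0\<close> by (metis half_gt_zero)
  define \<sigma> where "\<sigma> = min \<eta> (\<epsilon> / 2)"
  have "\<sigma> > 0" using \<open>\<eta> > 0\<close> \<open>\<epsilon> > 0\<close> by (simp add: \<sigma>_def)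
  obtain p :: nat where "max 1 ((hi - lo) / \<sigma>) < p"
    using reals_Archimedean2 by blast
  then have p: "(hi - lo) / \<sigma> < p" "0 < p" by (simp_all add: not_less)
  define d where "d = (hi - lo) / p"
  have d: "0 \<le> d" "d \<le> \<sigma>" and dp: "d * p = hi - lo"
    using p \<open>\<sigma> > 0\<close> \<open>lo \<le> hi\<close> by (auto simp: d_def field_simps)
  define pt where "pt = (\<lambda>(x :: nat \<Rightarrow> nat) i. lo + d * real (x i))"
  have pt: "pt x i \<in> {lo..hi}" if "x i \<le> p" for x i
    using mult_left_mono[of "real (x i)" "real p" d] that d dp by (auto simp: pt_def)
  \<comment> \<open>Points on the upper face get label \<open>1\<close> even if they are fixed in that coordinate, as Kuhn's
    lemma requires.\<close>
  define label where "label = (\<lambda>x i. if x i < p \<and> pt x i \<le> \<Psi> (pt x) i then 0 else 1 :: nat)"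
  obtain q where q: "\<forall>i<n. q i < p"
    and rs: "\<forall>i<n. \<exists>r s. (\<forall>j<n. q j \<le> r j \<and> r j \<le> q j + 1) \<and>
               (\<forall>j<n. q j \<le> s j \<and> s j \<le> q j + 1) \<and> label r i \<noteq> label s i"
  proof (rule kuhn_lemma[OF \<open>0 < p\<close>, of n label])
    show "\<forall>x. (\<forall>i<n. x i \<le> p) \<longrightarrow> (\<forall>i<n. x i = 0 \<longrightarrow> label x i = 0)"
      using maps pt \<open>0 < p\<close> by (auto simp: label_def pt_def)
  qed (auto simp: label_def)
  have near: "\<bar>\<Psi> (pt r) i - \<Psi> (pt q) i\<bar> \<le> \<epsilon> / 2"
    if "\<forall>j<n. q j \<le> r j \<and> r j \<le> q j + 1" "i < n" for r i
  proof (rule \<eta>[OF _ _ _ \<open>i < n\<close>])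
    show "\<forall>j<n. \<bar>pt r j - pt q j\<bar> \<le> \<eta>"
    proof (intro allI impI)
      fix j assume "j < n"
      then have "r j = q j \<or> r j = q j + 1" using that(1) by force
      then show "\<bar>pt r j - pt q j\<bar> \<le> \<eta>"
        using d \<open>\<eta> > 0\<close> by (auto simp: pt_def \<sigma>_def algebra_simps)
    qed
    show "\<forall>j<n. pt r j \<in> {lo..hi}"
      using that(1) q pt by (metis Suc_eq_plus1 Suc_leI le_trans)
    show "\<forall>j<n. pt q j \<in> {lo..hi}"
      using q pt by (metis less_imp_le)
  qed
  show thesis
  proof (rule that)
    show "pt q j \<in> {lo..hi}" if "j < n" for j
      using q pt that by (metis less_imp_le)
    fix i assume "i < n"
    obtain r s where r: "\<forall>j<n. q j \<le> r j \<and> r j \<le> q j + 1"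
      and s: "\<forall>j<n. q j \<le> s j \<and> s j \<le> q j + 1"
      and lr: "label r i = 0" and ls: "label s i \<noteq> 0"
    proof -
      obtain r s where "\<forall>j<n. q j \<le> r j \<and> r j \<le> q j + 1" "\<forall>j<n. q j \<le> s j \<and> s j \<le> q j + 1"
        "label r i \<noteq> label s i"
        using rs \<open>i < n\<close> by blast
      moreover from this(3) have "label r i = 0 \<or> label s i = 0"
        by (auto simp: label_def split: if_splits)
      ultimately show thesis using that[of r s] that[of s r] by (cases "label r i = 0") auto
    qed
    have sp: "\<forall>j<n. s j \<le> p" using s q by (metis Suc_eq_plus1 Suc_leI le_trans)
    have "pt q i \<le> pt r i"
      using r \<open>i < n\<close> d by (auto simp: pt_def intro!: mult_left_mono)
    moreover have "pt r i \<le> \<Psi> (pt r) i" using lr by (auto simp: label_def split: if_splits)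
    moreover have "\<Psi> (pt s) i \<le> pt s i"
    proof (cases "s i = p")
      case True
      then have "pt s i = hi" using dp by (simp add: pt_def)
      then show ?thesis using maps[of "pt s" i] sp pt \<open>i < n\<close> by auto
    qed (use ls sp \<open>i < n\<close> in \<open>auto simp: label_def split: if_splits\<close>)
    moreover have "pt s i \<le> pt q i + \<epsilon> / 2"
    proof -
      have "s i = q i \<or> s i = q i + 1" using s \<open>i < n\<close> by force
      then show ?thesis using d \<open>\<epsilon> > 0\<close> by (auto simp: pt_def \<sigma>_def algebra_simps)
    qed
    ultimately show "\<bar>\<Psi> (pt q) i - pt q i\<bar> \<le> \<epsilon>"
      using near[OF r \<open>i < n\<close>] near[OF s \<open>i < n\<close>] by linarith
  qed
qed

text \<open>
  The averages \<open>\<Sum>i<n. \<phi> i t * v i\<close> of finitely many numbers near given sample points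
  serve as the finite-dimensional family of functions in the discretization below. They preserve bounds on
  the \<open>v i\<close>, and at \<open>t\<close> they see only samples closer than \<open>\<eta>\<close>.
\<close>

lemma approximate_partition_of_unity:
  fixes S :: "'a :: metric_space set" and \<eta> :: real
  assumes "compact S" "\<eta> > 0"
  obtains n :: nat and c :: "nat \<Rightarrow> 'a" and \<phi> :: "nat \<Rightarrow> 'a \<Rightarrow> real"
  where "\<And>i. i < n \<Longrightarrow> c i \<in> S" "\<And>i. i < n \<Longrightarrow> continuous_on S (\<phi> i)"
    "\<And>i t. \<lbrakk>i < n; t \<in> S\<rbrakk> \<Longrightarrow> 0 \<le> \<phi> i t"
    "\<And>t. t \<in> S \<Longrightarrow> (\<Sum>i<n. \<phi> i t) = 1"
    "\<And>i t. \<lbrakk>i < n; t \<in> S; \<eta> \<le> dist t (c i)\<rbrakk> \<Longrightarrow> \<phi> i t = 0"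
proof -
  have "S \<subseteq> (\<Union>x\<in>S. ball x \<eta>)" using \<open>\<eta> > 0\<close> by auto
  then obtain K where K: "finite K" "K \<subseteq> S" "S \<subseteq> (\<Union>x\<in>K. ball x \<eta>)"
    using compactE_image[OF \<open>compact S\<close>, of S "\<lambda>x. ball x \<eta>"] by (metis open_ball)
  obtain c where "bij_betw c {0..<card K} K"
    using ex_bij_betw_nat_finite K(1) by blast
  then have cK: "c ` {..<card K} = K" by (simp add: bij_betw_def lessThan_atLeast0)
  define n where "n = card K"
  define w where "w = (\<lambda>i t. max 0 (\<eta> - dist t (c i)))"
  have w0: "0 \<le> w i t" for i t by (simp add: w_def)
  have pos: "0 < (\<Sum>i<n. w i t)" if "t \<in> S" for t
  proof -
    obtain i where "i < n" "dist (c i) t < \<eta>"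
    proof -
      obtain x where "x \<in> K" "dist x t < \<eta>" using K(3) \<open>t \<in> S\<close> by auto
      with cK obtain i where "i < card K" "x = c i" by blast
      with \<open>dist x t < \<eta>\<close> show thesis using that[of i] by (simp add: n_def)
    qed
    then show ?thesis
      by (intro sum_pos2[of _ i]) (auto simp: w_def dist_commute)
  qed
  show thesis
  proof (rule that[of n c "\<lambda>i t. w i t / (\<Sum>j<n. w j t)"])
    show "c i \<in> S" if "i < n" for i using that cK K(2) by (auto simp: n_def)
    show "continuous_on S (\<lambda>t. w i t / (\<Sum>j<n. w j t))" for i
      unfolding w_def
      by (intro continuous_intros ballI less_imp_neq[symmetric] pos[unfolded w_def])
    show "0 \<le> w i t / (\<Sum>j<n. w j t)" for i t
      by (intro divide_nonneg_nonneg sum_nonneg w0)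
    show "(\<Sum>i<n. w i t / (\<Sum>j<n. w j t)) = 1" if "t \<in> S" for t
      using pos[OF that] by (simp flip: sum_divide_distrib)
    show "w i t / (\<Sum>j<n. w j t) = 0" if "\<eta> \<le> dist t (c i)" for i t
      using that by (simp add: w_def)
  qed
qed

definition continuous_between :: "'a :: topological_space set \<Rightarrow> real \<Rightarrow> real \<Rightarrow> ('a \<Rightarrow> real) \<Rightarrow> bool" where
  "continuous_between S lo hi x \<longleftrightarrow> continuous_on S x \<and> (\<forall>t\<in>S. x t \<in> {lo..hi})"

text \<open>
  The proof discretizes \<open>\<Phi>\<close>: a vector \<open>v\<close> is sent to the averaged function \<open>I v\<close>, then to the values
  of \<open>\<Phi> (I v)\<close> at the sample points. If \<open>v\<close> is nearly fixed, equicontinuity makes \<open>\<Phi> (I v)\<close>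
  nearly equal to \<open>I v\<close> on all of \<open>S\<close>. Approximate fixed points of the form \<open>\<Phi> y\<close> are
  equicontinuous, hence have a uniformly convergent subsequence, and its limit is fixed.
\<close>

theorem schauder_order_interval:
  fixes S :: "'a :: euclidean_space set" and \<Phi> :: "('a \<Rightarrow> real) \<Rightarrow> 'a \<Rightarrow> real" and lo hi :: real
  defines "adm \<equiv> continuous_between S lo hi"
  assumes "compact S" "lo \<le> hi"
    and maps: "\<And>x t. \<lbrakk>adm x; t \<in> S\<rbrakk> \<Longrightarrow> \<Phi> x t \<in> {lo..hi}"
    and ucont: "\<And>\<epsilon>. \<epsilon> > 0 \<Longrightarrow> \<exists>\<eta>>0. \<forall>x y. adm x \<longrightarrow> adm y \<longrightarrow>
              (\<forall>t\<in>S. \<bar>x t - y t\<bar> \<le> \<eta>) \<longrightarrow> (\<forall>t\<in>S. \<bar>\<Phi> x t - \<Phi> y t\<bar> \<le> \<epsilon>)"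
    and equicont: "\<And>\<epsilon>. \<epsilon> > 0 \<Longrightarrow> \<exists>\<eta>>0. \<forall>x. adm x \<longrightarrow>
              (\<forall>s\<in>S. \<forall>t\<in>S. dist s t < \<eta> \<longrightarrow> \<bar>\<Phi> x s - \<Phi> x t\<bar> \<le> \<epsilon>)"
  obtains x where "adm x" "\<And>t. t \<in> S \<Longrightarrow> \<Phi> x t = x t"
proof -
  have adm_\<Phi>: "adm (\<Phi> x)" if adm: "adm x" for x
  proof -
    have "continuous_on S (\<Phi> x)"
      unfolding continuous_on_iff
    proof (intro ballI allI impI)
      fix s \<epsilon> assume "s \<in> S" "(0 :: real) < \<epsilon>"
      then obtain \<eta> where "\<eta> > 0" "\<forall>s\<in>S. \<forall>t\<in>S. dist s t < \<eta> \<longrightarrow> \<bar>\<Phi> x s - \<Phi> x t\<bar> \<le> \<epsilon> / 2"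
        using equicont[OF half_gt_zero] adm by metis
      then show "\<exists>d>0. \<forall>t\<in>S. dist t s < d \<longrightarrow> dist (\<Phi> x t) (\<Phi> x s) < \<epsilon>"
        using \<open>s \<in> S\<close> \<open>0 < \<epsilon>\<close> by (force simp: dist_real_def)
    qed
    then show ?thesis using maps[OF adm] by (simp add: adm_def continuous_between_def)
  qed
  have approx: "\<exists>y. adm y \<and> (\<forall>t\<in>S. \<bar>\<Phi> (\<Phi> y) t - \<Phi> y t\<bar> \<le> \<epsilon>)" if "\<epsilon> > 0" for \<epsilon>
  proof -
    obtain \<delta> where "\<delta> > 0" and \<delta>: "\<And>x y t. \<lbrakk>adm x; adm y; \<forall>t\<in>S. \<bar>x t - y t\<bar> \<le> \<delta>; t \<in> S\<rbrakk>
        \<Longrightarrow> \<bar>\<Phi> x t - \<Phi> y t\<bar> \<le> \<epsilon>"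
      using ucont[OF \<open>\<epsilon> > 0\<close>] by metis
    obtain \<eta> where "\<eta> > 0" and \<eta>: "\<And>x s t. \<lbrakk>adm x; s \<in> S; t \<in> S; dist s t < \<eta>\<rbrakk>
        \<Longrightarrow> \<bar>\<Phi> x s - \<Phi> x t\<bar> \<le> \<delta> / 2"
      using equicont[of "\<delta> / 2"] \<open>\<delta> > 0\<close> by (metis half_gt_zero)
    obtain n :: nat and c :: "nat \<Rightarrow> 'a" and \<phi> :: "nat \<Rightarrow> 'a \<Rightarrow> real" where c: "\<And>i. i < n \<Longrightarrow> c i \<in> S"
      and \<phi>: "\<And>i. i < n \<Longrightarrow> continuous_on S (\<phi> i)" "\<And>i t. \<lbrakk>i < n; t \<in> S\<rbrakk> \<Longrightarrow> 0 \<le> \<phi> i t"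
        "\<And>t. t \<in> S \<Longrightarrow> (\<Sum>i<n. \<phi> i t) = 1"
        "\<And>i t. \<lbrakk>i < n; t \<in> S; \<eta> \<le> dist t (c i)\<rbrakk> \<Longrightarrow> \<phi> i t = 0"
      by (rule approximate_partition_of_unity[OF \<open>compact S\<close> \<open>\<eta> > 0\<close>]) (rule that)
    define I where "I = (\<lambda>(v :: nat \<Rightarrow> real) t. \<Sum>i<n. \<phi> i t * v i)"
    have const: "(\<Sum>i<n. \<phi> i t * k) = k" if "t \<in> S" for t k
      using \<phi>(3)[OF that] by (simp flip: sum_distrib_right)
    have avg: "\<bar>I v t - k\<bar> \<le> \<rho>"
      if "t \<in> S" "\<And>i. \<lbrakk>i < n; dist t (c i) < \<eta>\<rbrakk> \<Longrightarrow> \<bar>v i - k\<bar> \<le> \<rho>" for v t k \<rho>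
    proof -
      have "\<bar>I v t - k\<bar> = \<bar>\<Sum>i<n. \<phi> i t * (v i - k)\<bar>"
        using const[OF \<open>t \<in> S\<close>, of k] by (simp add: I_def right_diff_distrib sum_subtractf)
      also have "\<dots> \<le> (\<Sum>i<n. \<phi> i t * \<rho>)"
      proof (rule order_trans[OF sum_abs], rule sum_mono)
        fix i assume "i \<in> {..<n}"
        then show "\<bar>\<phi> i t * (v i - k)\<bar> \<le> \<phi> i t * \<rho>"
          using that \<phi>(2,4)[of i t] 
          by (cases "dist t (c i) < \<eta>") (auto simp: abs_mult intro!: mult_left_mono)
      qed
      finally show ?thesis using const[OF \<open>t \<in> S\<close>] by simp
    qed
    have I_adm: "adm (I v)" if "\<forall>i<n. v i \<in> {lo..hi}" for v
    proof -
      have "I v t \<in> {lo..hi}" if "t \<in> S" for t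
        using avg[OF that, of v "(lo + hi) / 2" "(hi - lo) / 2"] \<open>\<forall>i<n. v i \<in> {lo..hi}\<close>
        by (fastforce simp: abs_le_iff field_simps)
      moreover have "continuous_on S (I v)"
        unfolding I_def by (intro continuous_intros \<phi>) auto
      ultimately show ?thesis by (simp add: adm_def continuous_between_def)
    qed
    have I_diff: "\<bar>I u t - I v t\<bar> \<le> \<rho>" if "t \<in> S" "\<forall>i<n. \<bar>u i - v i\<bar> \<le> \<rho>" for u v t \<rho>
    proof -
      have "I u t - I v t = I (\<lambda>i. u i - v i) t"
        by (simp add: I_def right_diff_distrib sum_subtractf)
      then show ?thesis using avg[OF that(1), of "\<lambda>i. u i - v i" 0 \<rho>] that(2) by simp
    qed
    obtain v where v: "\<And>j. j < n \<Longrightarrow> v j \<in> {lo..hi}"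
      and v': "\<And>i. i < n \<Longrightarrow> \<bar>\<Phi> (I v) (c i) - v i\<bar> \<le> \<delta> / 2"
    proof (rule approximate_fixed_point_box[of lo hi "\<delta> / 2" n "\<lambda>v i. \<Phi> (I v) (c i)"])
      fix \<epsilon>' :: real assume "\<epsilon>' > 0"
      from ucont[OF this] obtain \<theta> where "\<theta> > 0" and \<theta>: "\<forall>x y. adm x \<longrightarrow> adm y \<longrightarrow>
              (\<forall>t\<in>S. \<bar>x t - y t\<bar> \<le> \<theta>) \<longrightarrow> (\<forall>t\<in>S. \<bar>\<Phi> x t - \<Phi> y t\<bar> \<le> \<epsilon>')" by blast
      show "\<exists>\<eta>>0. \<forall>u v. (\<forall>j<n. u j \<in> {lo..hi}) \<longrightarrow> (\<forall>j<n. v j \<in> {lo..hi}) \<longrightarrow>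
              (\<forall>j<n. \<bar>u j - v j\<bar> \<le> \<eta>) \<longrightarrow> (\<forall>i<n. \<bar>\<Phi> (I u) (c i) - \<Phi> (I v) (c i)\<bar> \<le> \<epsilon>')"
      proof (intro exI[of _ \<theta>] conjI allI impI)
        fix u v i
        assume uv: "\<forall>j<n. u j \<in> {lo..hi}" "\<forall>j<n. v j \<in> {lo..hi}" "\<forall>j<n. \<bar>u j - v j\<bar> \<le> \<theta>"
          and "i < n"
        have "\<forall>t\<in>S. \<bar>I u t - I v t\<bar> \<le> \<theta>" using I_diff uv(3) by blast
        then show "\<bar>\<Phi> (I u) (c i) - \<Phi> (I v) (c i)\<bar> \<le> \<epsilon>'"
          using \<theta> I_adm[OF uv(1)] I_adm[OF uv(2)] c[OF \<open>i < n\<close>] by blast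
      qed fact
    qed (use \<open>lo \<le> hi\<close> \<open>\<delta> > 0\<close> maps I_adm c in auto)
    have "adm (I v)" using I_adm v by blast
    \<comment> \<open>Half of \<open>\<delta>\<close> pays for the error at the sample point, half for moving there from \<open>t\<close>.\<close>
    have "\<bar>\<Phi> (I v) t - I v t\<bar> \<le> \<delta>" if "t \<in> S" for t
    proof -
      have "\<bar>v i - \<Phi> (I v) t\<bar> \<le> \<delta>" if "i < n" "dist t (c i) < \<eta>" for i
        using v'[OF \<open>i < n\<close>] \<eta>[OF \<open>adm (I v)\<close> \<open>t \<in> S\<close> c[OF \<open>i < n\<close>] that(2)] by linarith
      from avg[of t v "\<Phi> (I v) t" \<delta>, OF that this] show ?thesis by (simp add: abs_minus_commute)
    qed
    then have "\<forall>t\<in>S. \<bar>\<Phi> (\<Phi> (I v)) t - \<Phi> (I v) t\<bar> \<le> \<epsilon>"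
      by (intro ballI \<delta>[OF adm_\<Phi>[OF \<open>adm (I v)\<close>] \<open>adm (I v)\<close>]) auto
    with \<open>adm (I v)\<close> show ?thesis by blast
  qed
  have "\<forall>k. \<exists>y. adm y \<and> (\<forall>t\<in>S. \<bar>\<Phi> (\<Phi> y) t - \<Phi> y t\<bar> \<le> inverse (real (Suc k)))"
    using approx by (simp del: of_nat_Suc)
  then obtain y where y: "\<And>k. adm (y k)"
    and y': "\<And>k t. t \<in> S \<Longrightarrow> \<bar>\<Phi> (\<Phi> (y k)) t - \<Phi> (y k) t\<bar> \<le> inverse (real (Suc k))"
    by metis
  obtain g k where g: "continuous_on S g" "strict_mono (k :: nat \<Rightarrow> nat)"
    and lim: "\<And>e. 0 < e \<Longrightarrow> \<exists>N. \<forall>n x. n \<ge> N \<and> x \<in> S \<longrightarrow> norm (\<Phi> (y (k n)) x - g x) < e"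
  proof (rule Arzela_Ascoli[OF \<open>compact S\<close>, of "\<lambda>k. \<Phi> (y k)" "max \<bar>lo\<bar> \<bar>hi\<bar>"])
    show "norm (\<Phi> (y n) t) \<le> max \<bar>lo\<bar> \<bar>hi\<bar>" if "t \<in> S" for n t
      using maps[OF y that, of n] by auto
    fix s :: 'a and \<epsilon> :: real assume "s \<in> S" "0 < \<epsilon>"
    then obtain \<eta> where "\<eta> > 0" and \<eta>: "\<And>x t. \<lbrakk>adm x; t \<in> S; dist s t < \<eta>\<rbrakk> \<Longrightarrow> \<bar>\<Phi> x s - \<Phi> x t\<bar> \<le> \<epsilon> / 2"
      using equicont[of "\<epsilon> / 2"] by (metis half_gt_zero)
    show "\<exists>d>0. \<forall>n t. t \<in> S \<and> norm (s - t) < d \<longrightarrow> norm (\<Phi> (y n) s - \<Phi> (y n) t) < \<epsilon>"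
    proof (intro exI[of _ \<eta>] conjI allI impI \<open>\<eta> > 0\<close>)
      fix n t assume "t \<in> S \<and> norm (s - t) < \<eta>"
      then show "norm (\<Phi> (y n) s - \<Phi> (y n) t) < \<epsilon>"
        using \<eta>[OF y, of t n] \<open>0 < \<epsilon>\<close> by (simp add: dist_norm)
    qed
  qed (rule that)
  have ptw: "(\<lambda>n. \<Phi> (y (k n)) t) \<longlonglongrightarrow> g t" if "t \<in> S" for t
    unfolding LIMSEQ_iff using lim that by blast
  have "adm g"
    unfolding adm_def continuous_between_def
  proof (intro conjI ballI g)
    fix t assume "t \<in> S"
    then show "g t \<in> {lo..hi}"
      using closed_sequentially[OF closed_atLeastAtMost _ ptw] maps[OF y] by blast
  qed
  have "\<Phi> g t = g t" if "t \<in> S" for t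
  proof -
    have "(\<lambda>n. \<Phi> (\<Phi> (y (k n))) t) \<longlonglongrightarrow> \<Phi> g t"
      unfolding LIMSEQ_iff
    proof (intro allI impI)
      fix \<epsilon> :: real assume "\<epsilon> > 0"
      then obtain \<eta> where "\<eta> > 0" and \<eta>: "\<forall>x y. adm x \<longrightarrow> adm y \<longrightarrow>
          (\<forall>t\<in>S. \<bar>x t - y t\<bar> \<le> \<eta>) \<longrightarrow> (\<forall>t\<in>S. \<bar>\<Phi> x t - \<Phi> y t\<bar> \<le> \<epsilon> / 2)"
        using ucont[of "\<epsilon> / 2"] by (metis half_gt_zero)
      obtain N where N: "\<And>n s. \<lbrakk>n \<ge> N; s \<in> S\<rbrakk> \<Longrightarrow> \<bar>\<Phi> (y (k n)) s - g s\<bar> < \<eta>"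
        using lim[OF \<open>\<eta> > 0\<close>] by (auto simp only: real_norm_def)
      have "\<bar>\<Phi> (\<Phi> (y (k n))) t - \<Phi> g t\<bar> \<le> \<epsilon> / 2" if "n \<ge> N" for n
        using \<eta> adm_\<Phi>[OF y] \<open>adm g\<close> N[OF that] \<open>t \<in> S\<close> by (meson less_imp_le)
      then show "\<exists>N. \<forall>n\<ge>N. norm (\<Phi> (\<Phi> (y (k n))) t - \<Phi> g t) < \<epsilon>"
        using \<open>\<epsilon> > 0\<close> by (intro exI[of _ N]) force
    qed
    moreover have "(\<lambda>n. \<Phi> (\<Phi> (y (k n))) t - \<Phi> (y (k n)) t) \<longlonglongrightarrow> 0"
    proof (rule Lim_null_comparison)
      show "\<forall>\<^sub>F n in sequentially. norm (\<Phi> (\<Phi> (y (k n))) t - \<Phi> (y (k n)) t)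
              \<le> inverse (real (Suc (k n)))"
        using y'[OF that] by (auto intro: always_eventually)
      show "(\<lambda>n. inverse (real (Suc (k n)))) \<longlonglongrightarrow> 0"
        using LIMSEQ_subseq_LIMSEQ[OF LIMSEQ_inverse_real_of_nat g(2)] by (simp add: o_def)
    qed
    from tendsto_add[OF this ptw[OF that]]
    have "(\<lambda>n. \<Phi> (\<Phi> (y (k n))) t) \<longlonglongrightarrow> g t" by simp
    ultimately show ?thesis using LIMSEQ_unique by blast
  qed
  with \<open>adm g\<close> show thesis using that by blast
qed

section \<open>Fixed points of the Green operator\<close>

text \<open>
  The constant \<open>1 / m\<^sup>2\<close> solves the linear problem with right-hand side \<open>1\<close>.
\<close>

lemma periodic_green_integral:
  assumes "periodic_green T a m G" "m \<noteq> 0" "t \<in> {0..T}"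
  shows "integral {0..T} (G t) = 1 / m\<^sup>2"
proof -
  have "periodic_solution T (\<lambda>t u u' u''. u'' + a * u' + m\<^sup>2 * u = 1) (\<lambda>t. 1 / m\<^sup>2)"
    unfolding periodic_solution_def
    by (rule exI[of _ "\<lambda>t. 0"], rule exI[of _ "\<lambda>t. 0"])
       (use \<open>m \<noteq> 0\<close> in \<open>auto intro!: derivative_eq_intros\<close>)
  note solution = this
  have "1 / m\<^sup>2 = integral {0..T} (\<lambda>\<tau>. G t \<tau> * 1)"
    by (rule assms(1)[unfolded periodic_green_def, THEN conjunct2, THEN spec, THEN mp,
          OF continuous_on_const, THEN conjunct2, THEN spec, THEN mp, OF solution,
          THEN bspec, OF \<open>t \<in> {0..T}\<close>])
  then show ?thesis by simp
qed

lemma periodic_solution_cong_relation: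
  assumes "periodic_solution T P x"
    and "\<And>t u' u''. t \<in> {0..T} \<Longrightarrow> P t (x t) u' u'' \<Longrightarrow> Q t (x t) u' u''"
  shows "periodic_solution T Q x"
  using assms unfolding periodic_solution_def by meson

lemma uniformly_continuous_pairE:
  fixes g :: "'a :: metric_space \<Rightarrow> 'b :: metric_space \<Rightarrow> 'c :: metric_space"
  assumes "compact A" "compact B" "continuous_on (A \<times> B) (\<lambda>(s, u). g s u)" "\<epsilon> > 0"
  obtains \<eta> where "\<eta> > 0" "\<And>s u t v. \<lbrakk>s \<in> A; u \<in> B; t \<in> A; v \<in> B; dist (s, u) (t, v) < \<eta>\<rbrakk>
    \<Longrightarrow> dist (g s u) (g t v) < \<epsilon>"
proof -
  have "uniformly_continuous_on (A \<times> B) (\<lambda>(s, u). g s u)"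
    by (rule compact_uniformly_continuous[OF assms(3) compact_Times[OF assms(1,2)]])
  then obtain \<eta> where "\<eta> > 0" and \<eta>: "\<And>p q. \<lbrakk>p \<in> A \<times> B; q \<in> A \<times> B; dist q p < \<eta>\<rbrakk>
      \<Longrightarrow> dist (case q of (s, u) \<Rightarrow> g s u) (case p of (s, u) \<Rightarrow> g s u) < \<epsilon>"
    using \<open>\<epsilon> > 0\<close> by (rule uniformly_continuous_onE) (rule that)
  show thesis
  proof (rule that[OF \<open>\<eta> > 0\<close>])
    show "dist (g s u) (g t v) < \<epsilon>"
      if "s \<in> A" "u \<in> B" "t \<in> A" "v \<in> B" "dist (s, u) (t, v) < \<eta>" for s u t v
      using \<eta>[of "(t, v)" "(s, u)"] that by simp
  qed
qed

text \<open>
  The inequality \<open>f t u \<le> m\<^sup>2 R\<close> is demanded only for \<open>u \<ge> \<kappa> R\<close>, so \<open>R\<close> need not be a supersolution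
  and the integral operator \<open>F\<close> need not respect it. Its truncation at \<open>R\<close> does. A
  fixed point \<open>x\<close> of the truncation at which \<open>F x\<close> exceeds \<open>R\<close> somewhere satisfies
  \<open>x \<ge> \<kappa> R\<close> everywhere by the cone property of \<open>G\<close>, and then the inequality applies
  at every time and refutes the excess.
\<close>

lemma periodic_solution_in_order_interval:
  fixes f :: "real \<Rightarrow> real \<Rightarrow> real"
  assumes "T \<ge> 0" "m > 0" and green: "periodic_green T a m G"
    and "0 < \<kappa>" "\<kappa> < 1"
    and cone: "\<And>s t \<tau>. \<lbrakk>s \<in> {0..T}; t \<in> {0..T}; \<tau> \<in> {0..T}\<rbrakk> \<Longrightarrow> \<kappa> * G t \<tau> \<le> G s \<tau>"
    and "0 < \<delta>" "\<delta> \<le> R"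
    and cont: "continuous_on ({0..T} \<times> {\<delta>..R}) (\<lambda>(t, u). f t u)"
    and lower: "\<And>t u. \<lbrakk>t \<in> {0..T}; u \<in> {\<delta>..R}\<rbrakk> \<Longrightarrow> m\<^sup>2 * \<delta> \<le> f t u"
    and upper: "\<And>t u. \<lbrakk>t \<in> {0..T}; u \<in> {\<delta>..R}; \<kappa> * R \<le> u\<rbrakk> \<Longrightarrow> f t u \<le> m\<^sup>2 * R"
  shows "\<exists>x. periodic_solution T (\<lambda>t u u' u''. u'' + a * u' + m\<^sup>2 * u = f t u) x \<and>
             (\<forall>t\<in>{0..T}. x t \<in> {\<delta>..R})"
proof -
  define F where "F = (\<lambda>x t. integral {0..T} (\<lambda>\<tau>. G t \<tau> * f \<tau> (x \<tau>)))"
  define adm where "adm = continuous_between {0..T} \<delta> R"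
  \<comment> \<open>Taking \<open>s = t\<close> in the cone inequality with \<open>\<kappa> < 1\<close> already forces positivity.\<close>
  have G_nonneg: "0 \<le> G t \<tau>" if "t \<in> {0..T}" "\<tau> \<in> {0..T}" for t \<tau>
  proof -
    have "0 \<le> (1 - \<kappa>) * G t \<tau>" using cone[OF that(1,1,2)] by (simp add: algebra_simps)
    then show ?thesis using \<open>\<kappa> < 1\<close> by (simp add: zero_le_mult_iff)
  qed
  have G_joint: "continuous_on ({0..T} \<times> {0..T}) (\<lambda>(t, \<tau>). G t \<tau>)"
    using green by (simp add: periodic_green_def)
  have G_cont: "continuous_on {0..T} (G t)" if "t \<in> {0..T}" for t
  proof -
    have pair: "continuous_on {0..T} (\<lambda>\<tau>. (t, \<tau>))" by (intro continuous_intros)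
    have "(\<lambda>\<tau>. (t, \<tau>)) ` {0..T} \<subseteq> {0..T} \<times> {0..T}" using that by auto
    from continuous_on_compose2[OF G_joint pair this] show ?thesis by simp
  qed
  note mass = periodic_green_integral[OF green less_imp_neq[OF \<open>m > 0\<close>, symmetric]]
  have h_cont: "continuous_on {0..T} (\<lambda>\<tau>. f \<tau> (x \<tau>))" if "adm x" for x
  proof -
    have pair: "continuous_on {0..T} (\<lambda>\<tau>. (\<tau>, x \<tau>))"
      using that by (intro continuous_on_Pair continuous_on_id) (simp add: adm_def continuous_between_def)
    have "(\<lambda>\<tau>. (\<tau>, x \<tau>)) ` {0..T} \<subseteq> {0..T} \<times> {\<delta>..R}" using that by (auto simp: adm_def continuous_between_def)
    from continuous_on_compose2[OF cont pair this] show ?thesis by simp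
  qed
  have Gh_int: "(\<lambda>\<tau>. G t \<tau> * f \<tau> (x \<tau>)) integrable_on {0..T}" if "adm x" "t \<in> {0..T}" for x t
    by (rule integrable_continuous_real[OF
          continuous_on_mult[OF G_cont[OF that(2)] h_cont[OF that(1)]]])
  have weighted: "integral {0..T} (\<lambda>\<tau>. G t \<tau> * k) = k / m\<^sup>2" if "t \<in> {0..T}" for t k
    using mass[OF that] by simp
  have Gk_int: "(\<lambda>\<tau>. G t \<tau> * k) integrable_on {0..T}" if "t \<in> {0..T}" for t k
    by (rule integrable_continuous_real[OF
          continuous_on_mult[OF G_cont[OF that] continuous_on_const]])
  have F_lower: "\<delta> \<le> F x t" if "adm x" "t \<in> {0..T}" for x t
  proof -
    have "integral {0..T} (\<lambda>\<tau>. G t \<tau> * (m\<^sup>2 * \<delta>)) \<le> F x t"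
      unfolding F_def
    proof (rule integral_le[OF Gk_int[OF that(2)] Gh_int[OF that]])
      fix \<tau> assume "\<tau> \<in> {0..T}"
      then show "G t \<tau> * (m\<^sup>2 * \<delta>) \<le> G t \<tau> * f \<tau> (x \<tau>)"
        using that lower[of \<tau> "x \<tau>"] G_nonneg[of t \<tau>] by (auto simp: adm_def continuous_between_def intro: mult_left_mono)
    qed
    then show ?thesis unfolding weighted[OF that(2)] using \<open>m > 0\<close> by simp
  qed
  have F_cone: "\<kappa> * F x t \<le> F x s" if "adm x" "s \<in> {0..T}" "t \<in> {0..T}" for x s t
  proof -
    have "\<kappa> * F x t = integral {0..T} (\<lambda>\<tau>. \<kappa> * G t \<tau> * f \<tau> (x \<tau>))"
      by (simp add: F_def mult.assoc)
    also have "\<dots> \<le> F x s"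
      unfolding F_def
    proof (rule integral_le)
      show "(\<lambda>\<tau>. \<kappa> * G t \<tau> * f \<tau> (x \<tau>)) integrable_on {0..T}"
        by (rule integrable_continuous_real[OF continuous_on_mult[OF
              continuous_on_mult[OF continuous_on_const G_cont[OF that(3)]] h_cont[OF that(1)]]])
      fix \<tau> assume "\<tau> \<in> {0..T}"
      have "0 \<le> m\<^sup>2 * \<delta>" using \<open>0 < \<delta>\<close> by simp
      also have "\<dots> \<le> f \<tau> (x \<tau>)" using lower \<open>\<tau> \<in> {0..T}\<close> that(1) by (simp add: adm_def continuous_between_def)
      finally show "\<kappa> * G t \<tau> * f \<tau> (x \<tau>) \<le> G s \<tau> * f \<tau> (x \<tau>)"
        by (rule mult_right_mono[OF cone[OF that(2,3) \<open>\<tau> \<in> {0..T}\<close>]])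
    qed (rule Gh_int[OF that(1,2)])
    finally show ?thesis .
  qed
  obtain x where x: "adm x" and fixed_pt: "\<And>t. t \<in> {0..T} \<Longrightarrow> min (F x t) R = x t"
  proof (rule schauder_order_interval[of "{0..T}" \<delta> R "\<lambda>x t. min (F x t) R", folded adm_def])
    show "compact {0..T}" "\<delta> \<le> R" by (simp, fact)
    show "min (F x t) R \<in> {\<delta>..R}" if "adm x" "t \<in> {0..T}" for x t
      using F_lower[OF that] \<open>\<delta> \<le> R\<close> by simp
  next
    fix \<epsilon> :: real assume "\<epsilon> > 0"
    then have "\<epsilon> * m\<^sup>2 > 0" using \<open>m > 0\<close> by simp
    obtain \<eta> where "\<eta> > 0" and \<eta>: "\<And>s u t v. \<lbrakk>s \<in> {0..T}; u \<in> {\<delta>..R}; t \<in> {0..T}; v \<in> {\<delta>..R};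
        dist (s, u) (t, v) < \<eta>\<rbrakk> \<Longrightarrow> dist (f s u) (f t v) < \<epsilon> * m\<^sup>2"
      by (rule uniformly_continuous_pairE[OF compact_Icc compact_Icc cont \<open>\<epsilon> * m\<^sup>2 > 0\<close>]) (rule that)
    have \<eta>': "\<bar>f t u - f t v\<bar> \<le> \<epsilon> * m\<^sup>2"
      if "t \<in> {0..T}" "u \<in> {\<delta>..R}" "v \<in> {\<delta>..R}" "\<bar>u - v\<bar> \<le> \<eta> / 2" for t u v
      using \<eta>[OF that(1,2) that(1,3)] that(4) \<open>\<eta> > 0\<close>
      by (simp add: dist_Pair_Pair dist_real_def)
    have "\<bar>min (F x t) R - min (F y t) R\<bar> \<le> \<epsilon>"
      if "adm x" "adm y" "\<forall>t\<in>{0..T}. \<bar>x t - y t\<bar> \<le> \<eta> / 2" "t \<in> {0..T}" for x y t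
    proof -
      have "F x t - F y t = integral {0..T} (\<lambda>\<tau>. G t \<tau> * f \<tau> (x \<tau>) - G t \<tau> * f \<tau> (y \<tau>))"
        unfolding F_def
        by (rule integral_diff[symmetric, OF Gh_int[OF that(1,4)] Gh_int[OF that(2,4)]])
      also have "norm \<dots> \<le> integral {0..T} (\<lambda>\<tau>. G t \<tau> * (\<epsilon> * m\<^sup>2))"
      proof (rule integral_norm_bound_integral[OF
            integrable_diff[OF Gh_int[OF that(1,4)] Gh_int[OF that(2,4)]] Gk_int[OF that(4)]])
        fix \<tau> assume "\<tau> \<in> {0..T}"
        then show "norm (G t \<tau> * f \<tau> (x \<tau>) - G t \<tau> * f \<tau> (y \<tau>)) \<le> G t \<tau> * (\<epsilon> * m\<^sup>2)"
          using that G_nonneg[of t \<tau>] \<eta>'[of \<tau> "x \<tau>" "y \<tau>"]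
          by (auto simp: adm_def continuous_between_def abs_mult simp flip: right_diff_distrib intro!: mult_left_mono)
      qed
      also have "\<dots> = \<epsilon>" using weighted[OF \<open>t \<in> {0..T}\<close>] \<open>m > 0\<close> by simp
      finally show ?thesis by (auto simp: min_def)
    qed
    then show "\<exists>\<eta>>0. \<forall>x y. adm x \<longrightarrow> adm y \<longrightarrow> (\<forall>t\<in>{0..T}. \<bar>x t - y t\<bar> \<le> \<eta>) \<longrightarrow>
        (\<forall>t\<in>{0..T}. \<bar>min (F x t) R - min (F y t) R\<bar> \<le> \<epsilon>)"
      using \<open>\<eta> > 0\<close> by (intro exI[of _ "\<eta> / 2"]) auto
  next
    fix \<epsilon> :: real assume "\<epsilon> > 0"
    have "bounded ((\<lambda>(t, u). f t u) ` ({0..T} \<times> {\<delta>..R}))"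
      by (intro compact_imp_bounded compact_continuous_image cont compact_Times compact_Icc)
    then obtain M where "M > 0" and M: "\<And>t u. \<lbrakk>t \<in> {0..T}; u \<in> {\<delta>..R}\<rbrakk> \<Longrightarrow> \<bar>f t u\<bar> \<le> M"
      unfolding bounded_pos by force
    \<comment> \<open>The factor \<open>T + 1\<close> instead of \<open>T\<close> avoids a division by zero when \<open>T = 0\<close>.\<close>
    define \<rho> where "\<rho> = \<epsilon> / (M * (T + 1))"
    have "\<rho> > 0" using \<open>\<epsilon> > 0\<close> \<open>M > 0\<close> \<open>T \<ge> 0\<close> by (simp add: \<rho>_def)
    have "\<rho> * M * T \<le> \<rho> * M * (T + 1)"
      using \<open>\<rho> > 0\<close> \<open>M > 0\<close> by (intro mult_left_mono) auto
    also have "\<dots> = \<epsilon>" using \<open>M > 0\<close> \<open>T \<ge> 0\<close> by (simp add: \<rho>_def)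
    finally have \<rho>: "\<rho> * M * T \<le> \<epsilon>" .
    obtain \<eta> where "\<eta> > 0" and \<eta>: "\<And>s u t v. \<lbrakk>s \<in> {0..T}; u \<in> {0..T}; t \<in> {0..T}; v \<in> {0..T};
        dist (s, u) (t, v) < \<eta>\<rbrakk> \<Longrightarrow> dist (G s u) (G t v) < \<rho>"
      by (rule uniformly_continuous_pairE[OF compact_Icc compact_Icc G_joint \<open>\<rho> > 0\<close>]) (rule that)
    have \<eta>': "\<bar>G s \<tau> - G t \<tau>\<bar> \<le> \<rho>"
      if "s \<in> {0..T}" "t \<in> {0..T}" "\<tau> \<in> {0..T}" "dist s t < \<eta>" for s t \<tau>
      using \<eta>[OF that(1,3) that(2,3)] that(4)
      by (simp add: dist_Pair_Pair dist_real_def)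
    have "\<bar>min (F x s) R - min (F x t) R\<bar> \<le> \<epsilon>"
      if "adm x" "s \<in> {0..T}" "t \<in> {0..T}" "dist s t < \<eta>" for x s t
    proof -
      have "F x s - F x t = integral {0..T} (\<lambda>\<tau>. G s \<tau> * f \<tau> (x \<tau>) - G t \<tau> * f \<tau> (x \<tau>))"
        unfolding F_def
        by (rule integral_diff[symmetric, OF Gh_int[OF that(1,2)] Gh_int[OF that(1,3)]])
      also have "norm \<dots> \<le> integral {0..T} (\<lambda>\<tau>. \<rho> * M)"
      proof (rule integral_norm_bound_integral[OF
            integrable_diff[OF Gh_int[OF that(1,2)] Gh_int[OF that(1,3)]] integrable_const_ivl])
        fix \<tau> assume "\<tau> \<in> {0..T}"
        then show "norm (G s \<tau> * f \<tau> (x \<tau>) - G t \<tau> * f \<tau> (x \<tau>)) \<le> \<rho> * M"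
          using that \<eta>'[of s t \<tau>] M[of \<tau> "x \<tau>"] \<open>\<rho> > 0\<close>
          by (auto simp: adm_def continuous_between_def abs_mult simp flip: left_diff_distrib intro!: mult_mono)
      qed
      also have "\<dots> = \<rho> * M * T" using \<open>T \<ge> 0\<close> by simp
      finally show ?thesis using \<rho> by (auto simp: min_def)
    qed
    then show "\<exists>\<eta>>0. \<forall>x. adm x \<longrightarrow> (\<forall>s\<in>{0..T}. \<forall>t\<in>{0..T}. dist s t < \<eta> \<longrightarrow>
        \<bar>min (F x s) R - min (F x t) R\<bar> \<le> \<epsilon>)"
      using \<open>\<eta> > 0\<close> by (intro exI[of _ \<eta>]) blast
  qed (rule that)
  have F_upper: "F x t \<le> R" if t: "t \<in> {0..T}" for t
  proof (rule ccontr)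
    assume "\<not> F x t \<le> R"
    have large: "\<kappa> * R \<le> x s" if "s \<in> {0..T}" for s
    proof -
      have "\<kappa> * R \<le> \<kappa> * F x t" using \<open>\<not> F x t \<le> R\<close> \<open>0 < \<kappa>\<close> by simp
      also have "\<dots> \<le> F x s" by (rule F_cone[OF x that t])
      finally have "\<kappa> * R \<le> F x s" .
      moreover have "\<kappa> * R \<le> 1 * R"
        using \<open>\<kappa> < 1\<close> \<open>0 < \<delta>\<close> \<open>\<delta> \<le> R\<close> by (intro mult_right_mono) auto
      ultimately show ?thesis using fixed_pt[OF that] by linarith
    qed
    have "F x t \<le> integral {0..T} (\<lambda>\<tau>. G t \<tau> * (m\<^sup>2 * R))"
      unfolding F_def
    proof (intro integral_le[OF Gh_int[OF x t] Gk_int[OF t]])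
      fix \<tau> assume "\<tau> \<in> {0..T}"
      then show "G t \<tau> * f \<tau> (x \<tau>) \<le> G t \<tau> * (m\<^sup>2 * R)"
        using x t large[of \<tau>] upper[of \<tau> "x \<tau>"] G_nonneg[of t \<tau>]
        by (auto simp: adm_def continuous_between_def intro: mult_left_mono)
    qed
    also have "\<dots> = R" using weighted[OF t] \<open>m > 0\<close> by simp
    finally show False using \<open>\<not> F x t \<le> R\<close> by simp
  qed
  have Fx: "F x t = x t" if "t \<in> {0..T}" for t
    using fixed_pt[OF that] F_upper[OF that] by simp
  have "periodic_solution T (\<lambda>t u u' u''. u'' + a * u' + m\<^sup>2 * u = f t (x t)) (F x)"
    unfolding F_def using green h_cont[OF x] by (simp add: periodic_green_def)
  then have "periodic_solution T (\<lambda>t u u' u''. u'' + a * u' + m\<^sup>2 * u = f t u) (F x)"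
    by (rule periodic_solution_cong_relation) (simp add: Fx)
  then show ?thesis using Fx x by (intro exI[of _ "F x"]) (auto simp: adm_def continuous_between_def)
qed

section \<open>The nonlinearity\<close>

text \<open>
  For \<open>y \<ge> c / e\<close> the left-hand side is nonpositive, while \<open>e \<le> E\<close> makes the right-hand
  side nonnegative. Between \<open>c / E\<close> and \<open>c / e\<close> each factor is
  largest at the opposite end, and the product of these two maxima is the right-hand side.
\<close>

lemma concave_parabola_bound:
  fixes c e E y :: real
  assumes "0 < c" "0 < e" "e \<le> E" "c / E \<le> y"
  shows "y * (c - e * y) \<le> c\<^sup>2 * (1 / e - 1 / E)"
proof (cases "c \<le> e * y")
  case True
  have "0 \<le> y" using assms by (meson divide_nonneg_nonneg less_imp_le order_trans)
  with True have "y * (c - e * y) \<le> 0" by (simp add: mult_nonneg_nonpos)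
  also have "0 \<le> c\<^sup>2 * (1 / e - 1 / E)" using assms by (simp add: frac_le)
  finally show ?thesis .
next
  case False
  have "y * (c - e * y) \<le> (c / e) * (c - e * (c / E))"
    using False assms by (intro mult_mono) (auto simp: field_simps)
  also have "\<dots> = c\<^sup>2 * (1 / e - 1 / E)" using assms by (simp add: field_simps power2_eq_square)
  finally show ?thesis .
qed

theorem theorem14:
  fixes a \<mu> c T m c\<^sub>m e_min e_max :: real
    and e :: "real \<Rightarrow> real"
    and G :: "real \<Rightarrow> real \<Rightarrow> real"
  assumes "a \<ge> 0" and "0 < \<mu>" and "\<mu> < 1 / 2" and "c > 0" and "T > 0"
    and "continuous_on {0..T} e"
    and "e_min = (LEAST v. v \<in> e ` {0..T})"
    and "e_max = (GREATEST v. v \<in> e ` {0..T})"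
    and "e_min > 0"
    and "m > 0"
    and "periodic_green T a m G"
    and "0 < c\<^sub>m" and "c\<^sub>m < 1"
    and "\<forall>t\<in>{0..T}. \<forall>\<tau>\<in>{0..T}. G t \<tau> \<ge> G \<tau> \<tau> \<and> G \<tau> \<tau> \<ge> c\<^sub>m * G t \<tau>"
    and "c\<^sup>2 / (\<mu> * e_min\<^sup>2) * (1 / c\<^sub>m powr \<mu> * e_max - e_min) \<le> m\<^sup>2"
    and "m\<^sup>2 < (pi / T)\<^sup>2 + (a / 2)\<^sup>2"
  shows "\<exists>x. periodic_solution T
               (\<lambda>t u u' u''. u'' + a * u' =
                  e t / \<mu> * u powr (1 - 2 * \<mu>) - c / \<mu> * u powr (1 - \<mu>)) x \<and>
             (\<forall>t\<in>{0..T}. 0 < x t \<and> x t \<le> 1 / c\<^sub>m * (e_max / c) powr (1 / \<mu>))"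
proof -
  have e_bounds: "e_min \<le> e t \<and> e t \<le> e_max" if "t \<in> {0..T}" for t
  proof -
    have ne: "{0..T} \<noteq> {}" using \<open>T > 0\<close> by simp
    obtain s where s: "s \<in> {0..T}" "\<forall>t\<in>{0..T}. e s \<le> e t"
      using continuous_attains_inf[OF compact_Icc ne \<open>continuous_on {0..T} e\<close>] by blast
    obtain r where r: "r \<in> {0..T}" "\<forall>t\<in>{0..T}. e t \<le> e r"
      using continuous_attains_sup[OF compact_Icc ne \<open>continuous_on {0..T} e\<close>] by blast
    have "e_min = e s" unfolding assms(7) using s by (intro Least_equality) auto
    moreover have "e_max = e r" unfolding assms(8) using r by (intro Greatest_equality) auto
    ultimately show ?thesis using s r that by auto
  qed
  then have "e_min \<le> e_max" using \<open>T > 0\<close> by (meson atLeastAtMost_iff less_imp_le order_refl order_trans)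
  \<comment> \<open>\<open>E\<close> is chosen such that \<open>R powr (- \<mu>) = c / E\<close>; it makes the hypothesis on \<open>m\<close> read
    \<open>c\<^sup>2 (E - e_min) / (\<mu> * e_min\<^sup>2) \<le> m\<^sup>2\<close>.\<close>
  define E where "E = e_max / c\<^sub>m powr \<mu>"
  have cm_powr: "0 < c\<^sub>m powr \<mu>" "c\<^sub>m powr \<mu> < 1"
    using \<open>0 < c\<^sub>m\<close> \<open>c\<^sub>m < 1\<close> \<open>0 < \<mu>\<close> powr_less_mono2[of \<mu> c\<^sub>m 1] by auto
  have "e_max < E"
    using cm_powr \<open>e_min > 0\<close> \<open>e_min \<le> e_max\<close> by (simp add: E_def field_simps)
  define R where "R = 1 / c\<^sub>m * (e_max / c) powr (1 / \<mu>)"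
  define \<alpha> where "\<alpha> = (e_min / c) powr (1 / \<mu>)"
  have "R > 0" "\<alpha> > 0"
    using \<open>0 < c\<^sub>m\<close> \<open>e_min > 0\<close> \<open>e_min \<le> e_max\<close> \<open>c > 0\<close> by (auto simp: R_def \<alpha>_def)
  define f where "f = (\<lambda>t u. m\<^sup>2 * u + (e t / \<mu> * u powr (1 - 2 * \<mu>) - c / \<mu> * u powr (1 - \<mu>)))"
  have f_eq: "f t u = u * (m\<^sup>2 - u powr (- \<mu>) * (c - e t * u powr (- \<mu>)) / \<mu>)" if "u > 0" for t u
  proof -
    have "u powr (1 - \<mu>) = u * u powr (- \<mu>)"
      using that by (simp add: powr_mult_base)
    moreover have "u powr (1 - 2 * \<mu>) = u * (u powr (- \<mu>) * u powr (- \<mu>))"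
      using that by (simp add: powr_mult_base flip: powr_add)
    ultimately show ?thesis using \<open>0 < \<mu>\<close> by (simp add: f_def field_simps)
  qed
  have level: "((k / c) powr (1 / \<mu>)) powr (- \<mu>) = c / k" if "k > 0" for k
    using that \<open>c > 0\<close> \<open>0 < \<mu>\<close> by (simp add: powr_powr powr_minus_divide)
  have R_level: "R powr (- \<mu>) = c / E"
  proof -
    have "R powr (- \<mu>) = (1 / c\<^sub>m) powr (- \<mu>) * ((e_max / c) powr (1 / \<mu>)) powr (- \<mu>)"
      unfolding R_def by (rule powr_mult)
    also have "(1 / c\<^sub>m) powr (- \<mu>) = c\<^sub>m powr \<mu>"
      using \<open>0 < c\<^sub>m\<close> by (simp add: powr_divide powr_minus_divide)
    finally show ?thesis using level[of e_max] \<open>e_min > 0\<close> \<open>e_min \<le> e_max\<close> by (simp add: E_def)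
  qed
  have powr_anti: "v powr (- \<mu>) \<le> u powr (- \<mu>)" if "0 < u" "u \<le> v" for u v
    using that \<open>0 < \<mu>\<close> powr_mono2'[of "- \<mu>" u v] by simp
  define \<rho> where "\<rho> = m\<^sup>2 - c\<^sup>2 * (1 / e_min - 1 / E) / \<mu>"
  have "\<rho> > 0"
  proof -
    have "c\<^sup>2 * (1 / e_min - 1 / E) / \<mu> = c\<^sup>2 / \<mu> * ((E - e_min) / (e_min * E))"
      using \<open>e_min > 0\<close> \<open>e_min \<le> e_max\<close> \<open>e_max < E\<close> by (simp add: diff_frac_eq)
    \<comment> \<open>\<open>e_min < E\<close> holds because \<open>c\<^sub>m < 1\<close>, hence the strict inequality.\<close>
    also have "\<dots> < c\<^sup>2 / \<mu> * ((E - e_min) / (e_min * e_min))"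
      using \<open>e_min > 0\<close> \<open>e_min \<le> e_max\<close> \<open>e_max < E\<close> \<open>c > 0\<close> \<open>0 < \<mu>\<close>
      by (intro mult_strict_left_mono divide_strict_left_mono) auto
    also have "\<dots> = c\<^sup>2 / (\<mu> * e_min\<^sup>2) * (1 / c\<^sub>m powr \<mu> * e_max - e_min)"
      by (simp add: E_def power2_eq_square)
    also have "\<dots> \<le> m\<^sup>2" by fact
    finally show ?thesis by (simp add: \<rho>_def)
  qed
  have f_lower: "\<rho> * u \<le> f t u" if "t \<in> {0..T}" "0 < u" "u \<le> R" for t u
  proof -
    have "u powr (- \<mu>) * (c - e t * u powr (- \<mu>)) \<le> c\<^sup>2 * (1 / e t - 1 / E)"
      using e_bounds[OF that(1)] \<open>e_min > 0\<close> \<open>c > 0\<close> \<open>e_max < E\<close> powr_anti[OF that(2,3)]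
      by (intro concave_parabola_bound) (auto simp: R_level)
    also have "\<dots> \<le> c\<^sup>2 * (1 / e_min - 1 / E)"
      using e_bounds[OF that(1)] \<open>e_min > 0\<close> by (intro mult_left_mono) (auto simp: frac_le)
    finally have "\<rho> \<le> m\<^sup>2 - u powr (- \<mu>) * (c - e t * u powr (- \<mu>)) / \<mu>"
      using \<open>0 < \<mu>\<close> by (simp add: \<rho>_def divide_right_mono)
    then show ?thesis unfolding f_eq[OF \<open>0 < u\<close>] using \<open>0 < u\<close> by (simp add: mult.commute)
  qed
  have f_small: "m\<^sup>2 * u \<le> f t u" if "t \<in> {0..T}" "0 < u" "u \<le> \<alpha>" for t u
  proof -
    have "c / e_min \<le> u powr (- \<mu>)"
      using powr_anti[OF that(2,3)] level[OF \<open>e_min > 0\<close>] by (simp add: \<alpha>_def)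
    then have "c \<le> e_min * u powr (- \<mu>)" using \<open>e_min > 0\<close> by (simp add: field_simps)
    also have "\<dots> \<le> e t * u powr (- \<mu>)" using e_bounds[OF that(1)] by (intro mult_right_mono) auto
    finally have "u powr (- \<mu>) * (c - e t * u powr (- \<mu>)) / \<mu> \<le> 0"
      using \<open>0 < \<mu>\<close> by (simp add: divide_nonpos_pos mult_nonneg_nonpos)
    then show ?thesis unfolding f_eq[OF \<open>0 < u\<close>] using \<open>0 < u\<close>
      by (subst mult.commute) (intro mult_left_mono, auto)
  qed
  have f_large: "f t u \<le> m\<^sup>2 * u" if "t \<in> {0..T}" "c\<^sub>m * R \<le> u" for t u
  proof -
    have "0 < u" using that(2) \<open>0 < c\<^sub>m\<close> \<open>R > 0\<close> by (meson less_le_trans mult_pos_pos)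
    have "(e_max / c) powr (1 / \<mu>) \<le> u" using that(2) \<open>0 < c\<^sub>m\<close> by (simp add: R_def)
    then have "u powr (- \<mu>) \<le> c / e_max"
      using powr_anti[of "(e_max / c) powr (1 / \<mu>)" u] level[of e_max]
        \<open>e_min > 0\<close> \<open>e_min \<le> e_max\<close> \<open>c > 0\<close> by simp
    then have "e_max * u powr (- \<mu>) \<le> c" using \<open>e_min > 0\<close> \<open>e_min \<le> e_max\<close> by (simp add: field_simps)
    then have "e t * u powr (- \<mu>) \<le> c"
      using e_bounds[OF that(1)] by (meson mult_right_mono order_trans powr_ge_zero)
    then have "0 \<le> u powr (- \<mu>) * (c - e t * u powr (- \<mu>)) / \<mu>"
      using \<open>0 < \<mu>\<close> by simp
    then show ?thesis unfolding f_eq[OF \<open>0 < u\<close>] using \<open>0 < u\<close>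
      by (subst (2) mult.commute) (intro mult_left_mono, auto)
  qed
  \<comment> \<open>Below \<open>\<alpha>\<close> the bound \<open>m\<^sup>2 \<delta> \<le> f t u\<close> follows from \<open>m\<^sup>2 u \<le> f t u\<close>, above \<open>\<alpha>\<close> from
    \<open>\<rho> \<alpha> \<le> \<rho> u \<le> f t u\<close>; the third entry of the minimum serves the second case.\<close>
  define \<delta> where "\<delta> = Min {\<alpha>, R, \<rho> * \<alpha> / m\<^sup>2}"
  have \<delta>: "0 < \<delta>" "\<delta> \<le> \<alpha>" "\<delta> \<le> R" "m\<^sup>2 * \<delta> \<le> \<rho> * \<alpha>"
  proof -
    show "0 < \<delta>" "\<delta> \<le> \<alpha>" "\<delta> \<le> R"
      using \<open>R > 0\<close> \<open>\<alpha> > 0\<close> \<open>\<rho> > 0\<close> \<open>m > 0\<close> by (auto simp: \<delta>_def)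
    have "\<delta> \<le> \<rho> * \<alpha> / m\<^sup>2" by (simp add: \<delta>_def)
    then show "m\<^sup>2 * \<delta> \<le> \<rho> * \<alpha>" using \<open>m > 0\<close> by (simp add: field_simps)
  qed
  have "\<exists>x. periodic_solution T (\<lambda>t u u' u''. u'' + a * u' + m\<^sup>2 * u = f t u) x \<and>
             (\<forall>t\<in>{0..T}. x t \<in> {\<delta>..R})"
  proof (rule periodic_solution_in_order_interval)
    show "continuous_on ({0..T} \<times> {\<delta>..R}) (\<lambda>(t, u). f t u)"
      unfolding f_def case_prod_unfold
      using \<delta>(1) \<open>0 < \<mu>\<close>
      by (auto intro!: continuous_intros continuous_on_compose2[OF \<open>continuous_on {0..T} e\<close>])
    show "c\<^sub>m * G t \<tau> \<le> G s \<tau>" if "s \<in> {0..T}" "t \<in> {0..T}" "\<tau> \<in> {0..T}" for s t \<tau>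
      using assms(14) that by (meson order_trans)
    show "m\<^sup>2 * \<delta> \<le> f t u" if "t \<in> {0..T}" "u \<in> {\<delta>..R}" for t u
    proof (cases "u \<le> \<alpha>")
      case True
      have "m\<^sup>2 * \<delta> \<le> m\<^sup>2 * u" using that by (simp add: mult_left_mono)
      also have "\<dots> \<le> f t u" using f_small[of t u] that True \<delta>(1) by simp
      finally show ?thesis .
    next
      case False
      have "m\<^sup>2 * \<delta> \<le> \<rho> * \<alpha>" by (fact \<delta>)
      also have "\<dots> \<le> \<rho> * u" using False \<open>\<rho> > 0\<close> by simp
      also have "\<dots> \<le> f t u" using f_lower[of t u] that \<delta>(1) by simp
      finally show ?thesis .
    qed
    show "f t u \<le> m\<^sup>2 * R" if "t \<in> {0..T}" "u \<in> {\<delta>..R}" "c\<^sub>m * R \<le> u" for t u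
    proof -
      have "f t u \<le> m\<^sup>2 * u" using f_large that by blast
      also have "\<dots> \<le> m\<^sup>2 * R" using that by (simp add: mult_left_mono)
      finally show ?thesis .
    qed
  qed (use assms \<delta> in auto)
  then obtain x where x: "periodic_solution T (\<lambda>t u u' u''. u'' + a * u' + m\<^sup>2 * u = f t u) x"
    and x_bounds: "\<forall>t\<in>{0..T}. x t \<in> {\<delta>..R}" by blast
  have "periodic_solution T (\<lambda>t u u' u''. u'' + a * u' =
          e t / \<mu> * u powr (1 - 2 * \<mu>) - c / \<mu> * u powr (1 - \<mu>)) x"
    using x by (rule periodic_solution_cong_relation) (simp add: f_def)
  then show ?thesis using x_bounds \<delta>(1) unfolding R_def by (meson atLeastAtMost_iff less_le_trans)
qed

end
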